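(* Let $L$ be a finite proper signed alphabet, let $\lambda\vdash n$ be a partition and let $p\ge 1$ be an integer. Let $S_\lambda\in R_L$ be the (formal) sum of all super semistandard Young tableaux of shape $\lambda$ over $L$, and let $S_{(p)}\in R_L$ be the sum of all row words of length $p$. Then $$S_\lambda\cdot S_{(p)}=\sum_\mu S_\mu,$$ where $\mu$ runs over all partitions of $n+p$ such that $\lambda\subseteq\mu$ and no two boxes of $\mu/\lambda$ occur in the same column.
   Context: A signed alphabet is a totally ordered set $L$ (here finite) together with a map $|\cdot|:L\to\mathbb{Z}_2=\{0,1\}$; $L_0=\{a: |a|=0\}$, $L_1=\{a:|a|=1\}$. It is proper if $L_0$ and $L_1$ are both nonempty. No relation between the order and the map $|\cdot|$ is assumed. For a partition $\lambda=(\lambda_1\ge\dots\ge\lambda_m>0)$, let $D(\lambda)=\{(i,j): 1\le i\le m,\ 1\le j\le\lambda_i\}$. We write $\lambda\subseteq\mu$ if $D(\lambda)\subseteq D(\mu)$, and then $\mu/\lambda$ denotes the set of boxes $D(\mu)\setminus D(\lambda)$. A super semistandard Young tableau over $L$ of shape $\lambda$ is a pair $T=(\lambda,\tau)$ with $\tau:D(\lambda)\to L$ such that, whenever the boxes involved lie in $D(\lambda)$: (i) $\tau(i,j)\le\tau(i,j+1)$, with $\tau(i,j)=\tau(i,j+1)$ only if $|\tau(i,j)|=0$; (ii) $\tau(i,j)\le\tau(i+1,j)$, with $\tau(i,j)=\tau(i+1,j)$ only if $|\tau(i,j)|=1$. $\mathcal{M}(L)$ is the free monoid of words in letters of $L$.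 A row word is a word $x_1\cdots x_p$ with $x_i\le x_{i+1}$ for all $i$, and $x_i=x_{i+1}$ only if $|x_i|=0$. For a tableau $T$, $w(T)$ is the word obtained by concatenating the rows of $T$ (each read left to right) from the bottom row up to the top row. $\equiv$ is the congruence on $\mathcal{M}(L)$ generated by the following relations, for all letters $x\le y\le z$ of $L$: (K1) $xzy\equiv zxy$, whenever ($x=y$ only if $|y|=0$) and ($y=z$ only if $|y|=1$); (K2) $yxz\equiv yzx$, whenever ($x=y$ only if $|y|=1$) and ($y=z$ only if $|y|=0$). The super plactic monoid is $\mathrm{Pl}(L)=\mathcal{M}(L)/\equiv$, and $R_L=\mathbb{Z}[\mathrm{Pl}(L)]$ is its monoid ring over $\mathbb{Z}$. A tableau $T$ is regarded as the element of $R_L$ given by the class of $w(T)$ in $\mathrm{Pl}(L)$, and a word is regarded as the element given by its class. *)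

theory Defs
  imports "HOL-Library.Poly_Mapping" "HOL-Library.Z2" "HOL-Library.FuncSet"
begin

class signed_alphabet = linorder +
  fixes parity :: "'a \<Rightarrow> bit"

definition even_letters :: "'a::signed_alphabet set" where
  "even_letters = {a. parity a = 0}"

definition odd_letters :: "'a::signed_alphabet set" where
  "odd_letters = {a. parity a = 1}"

definition partitions :: "nat \<Rightarrow> nat list set" where
  "partitions n = {lam. sorted_wrt (\<ge>) lam \<and> 0 \<notin> set lam \<and> sum_list lam = n}"

text \<open>Boxes are numbered from 1 (matrix coordinates: row, column), lists from 0.\<close>

definition diagram :: "nat list \<Rightarrow> (nat \<times> nat) set" where
  "diagram lam = {(i, j). 1 \<le> i \<and> i \<le> length lam \<and> 1 \<le> j \<and> j \<le> lam ! (i - 1)}"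

type_synonym 'a tableau = "nat list \<times> (nat \<times> nat \<Rightarrow> 'a)"

text \<open>Fillings are extensional functions on the diagram, so that two tableaux of the same
  shape are equal iff they agree on all boxes.\<close>

definition tableaux :: "nat list \<Rightarrow> 'a::signed_alphabet tableau set" where
  "tableaux lam = {(lam, t) | t.
     t \<in> diagram lam \<rightarrow>\<^sub>E UNIV \<and>
     (\<forall>i j. (i, j) \<in> diagram lam \<and> (i, j + 1) \<in> diagram lam \<longrightarrow>
        t (i, j) \<le> t (i, j + 1) \<and> (t (i, j) = t (i, j + 1) \<longrightarrow> parity (t (i, j)) = 0)) \<and>
     (\<forall>i j. (i, j) \<in> diagram lam \<and> (i + 1, j) \<in> diagram lam \<longrightarrow>
        t (i, j) \<le> t (i + 1, j) \<and> (t (i, j) = t (i + 1, j) \<longrightarrow> parity (t (i, j)) = 1))}"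

definition reading_word :: "'a tableau \<Rightarrow> 'a list" where
  "reading_word T = (case T of (lam, t) \<Rightarrow>
     concat (map (\<lambda>i. map (\<lambda>j. t (i, j)) [1..<lam ! (i - 1) + 1]) (rev [1..<length lam + 1])))"

definition row_words :: "nat \<Rightarrow> 'a::signed_alphabet list set" where
  "row_words p = {w. length w = p \<and>
     (\<forall>i. i + 1 < p \<longrightarrow> w ! i \<le> w ! (i + 1) \<and> (w ! i = w ! (i + 1) \<longrightarrow> parity (w ! i) = 0))}"

inductive plactic_equiv :: "'a::signed_alphabet list \<Rightarrow> 'a list \<Rightarrow> bool" where
  K1: "\<lbrakk>x \<le> y; y \<le> z; x = y \<longrightarrow> parity y = 0; y = z \<longrightarrow> parity y = 1\<rbrakk>
        \<Longrightarrow> plactic_equiv [x, z, y] [z, x, y]"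
| K2: "\<lbrakk>x \<le> y; y \<le> z; x = y \<longrightarrow> parity y = 1; y = z \<longrightarrow> parity y = 0\<rbrakk>
        \<Longrightarrow> plactic_equiv [y, x, z] [y, z, x]"
| plactic_refl: "plactic_equiv u u"
| plactic_sym: "plactic_equiv u v \<Longrightarrow> plactic_equiv v u"
| plactic_trans: "\<lbrakk>plactic_equiv u v; plactic_equiv v w\<rbrakk> \<Longrightarrow> plactic_equiv u w"
| plactic_append: "\<lbrakk>plactic_equiv u u'; plactic_equiv v v'\<rbrakk> \<Longrightarrow> plactic_equiv (u @ v) (u' @ v')"

lemma equivp_plactic_equiv: "equivp plactic_equiv"
  by (intro equivpI reflpI sympI transpI)
     (blast intro: plactic_refl plactic_sym plactic_trans)+

quotient_type (overloaded) 'a plactic = "'a::signed_alphabet list" / plactic_equiv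
  by (rule equivp_plactic_equiv)

text \<open>The super plactic monoid is written additively (non-commutatively), since the ring
  structure on \<open>'b \<Rightarrow>\<^sub>0 'c\<close> is the convolution product with respect to \<open>+\<close> on \<open>'b\<close>.\<close>

instantiation plactic :: (signed_alphabet) monoid_add
begin

lift_definition zero_plactic :: "'a plactic" is "[]" .

lift_definition plus_plactic :: "'a plactic \<Rightarrow> 'a plactic \<Rightarrow> 'a plactic" is "(@)"
  by (rule plactic_append)

instance
  by standard (transfer; simp add: plactic_refl)+

end

type_synonym 'a plactic_ring = "'a plactic \<Rightarrow>\<^sub>0 int"

definition word_elem :: "'a::signed_alphabet list \<Rightarrow> 'a plactic_ring" where
  "word_elem w = Poly_Mapping.single (abs_plactic w) 1"

definition S_shape :: "nat list \<Rightarrow> 'a::signed_alphabet plactic_ring" where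
  "S_shape lam = (\<Sum>T\<in>tableaux lam. word_elem (reading_word T))"

definition S_row :: "nat \<Rightarrow> 'a::signed_alphabet plactic_ring" where
  "S_row p = (\<Sum>w\<in>row_words p. word_elem w)"

definition horizontal_strip_extensions :: "nat list \<Rightarrow> nat \<Rightarrow> nat list set" where
  "horizontal_strip_extensions lam m = {mu \<in> partitions m.
     diagram lam \<subseteq> diagram mu \<and> inj_on snd (diagram mu - diagram lam)}"

text \<open>All the sums involved are over finite sets.\<close>

lemma finite_diagram: "finite (diagram lam)"
proof -
  have "diagram lam = Sigma {1..length lam} (\<lambda>i. {1..lam ! (i - 1)})"
    by (auto simp: diagram_def)
  then show ?thesis by simp
qed

lemma finite_tableaux: "finite (tableaux lam :: 'a::{finite,signed_alphabet} tableau set)"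
proof (rule finite_subset)
  show "tableaux lam \<subseteq> {lam} \<times> (diagram lam \<rightarrow>\<^sub>E (UNIV :: 'a set))"
    by (auto simp: tableaux_def)
  show "finite ({lam} \<times> (diagram lam \<rightarrow>\<^sub>E (UNIV :: 'a set)))"
    by (intro finite_cartesian_product finite_PiE finite_diagram) auto
qed

lemma finite_row_words: "finite (row_words p :: 'a::{finite,signed_alphabet} list set)"
proof (rule finite_subset)
  show "row_words p \<subseteq> {w. set w \<subseteq> (UNIV :: 'a set) \<and> length w = p}"
    by (auto simp: row_words_def)
qed (intro finite_lists_length_eq finite)

lemma length_le_sum_list: "0 \<notin> set lam \<Longrightarrow> length lam \<le> sum_list (lam :: nat list)"
  by (induction lam) auto

lemma finite_partitions: "finite (partitions n)"
proof (rule finite_subset)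
  show "partitions n \<subseteq> {lam. set lam \<subseteq> {..n} \<and> length lam \<le> n}"
    using length_le_sum_list by (auto simp: partitions_def intro: member_le_sum_list)
qed (intro finite_lists_length_le finite_atMost)

lemma finite_horizontal_strip_extensions: "finite (horizontal_strip_extensions lam m)"
  unfolding horizontal_strip_extensions_def by (simp add: finite_partitions)

end

theory Submission imports Defs "HOL-Library.Sublist" begin

text \<open>
  The identity is proved term by term. Row insertion assigns to a tableau \<open>T\<close> of shape \<open>lam\<close> and a
  row word \<open>w\<close> of length \<open>p\<close> a tableau \<open>U\<close> whose reading word is plactically equivalent to the
  reading word of \<open>T\<close> followed by \<open>w\<close>; as \<open>(T, w)\<close> varies, \<open>U\<close> runs exactly once through
  all tableaux whose shape extends \<open>lam\<close> by a horizontal strip of size \<open>p\<close>. Summing the classes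
  gives the theorem. That a plactic class contains only one tableau is not needed.

  Everything is governed by one relation: write \<open>a R b\<close> if \<open>a\<close> may stand immediately to the left
  of \<open>b\<close> in a row, and \<open>b C a\<close> if \<open>b\<close> may stand immediately above \<open>a\<close> in a column. Then \<open>b C a\<close>
  is the negation of \<open>a R b\<close>, and both relations are transitive. Parity enters in no other way, so
  the argument follows the classical one with \<open>R\<close> for \<open>\<le>\<close> and \<open>C\<close> for \<open><\<close>.

  The whole word \<open>w\<close> is inserted in one pass over each row of \<open>T\<close>, from the top row down. Inserting
  \<open>w\<close> in a row \<open>r\<close> gives a new row \<open>s @ t\<close>, with \<open>s\<close> as long as \<open>r\<close>, and a row word \<open>e\<close>
  of bumped letters, which is inserted in the next row (relation \<open>bump\<close>). Scanning \<open>r\<close> from left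
  to right, the first letter \<open>x\<close> not yet inserted replaces the letter \<open>a\<close> under the scanner iff
  \<open>x C a\<close>. The scan can be undone from right to left: the last letter \<open>z\<close> of \<open>s\<close> was inserted
  iff \<open>z C y\<close> for the last bumped letter \<open>y\<close>. This makes \<open>bump\<close> a bijection between pairs of rows
  \<open>(r, w)\<close> and triples \<open>(s, e, t)\<close> such that \<open>s @ t\<close> and \<open>e\<close> are rows and \<open>e\<close> fits below \<open>s\<close>
  (\<open>bump_rows\<close>, \<open>bump_injective\<close>, \<open>bump_surjective\<close>), and \<open>r @ w\<close> is equivalent to
  \<open>e @ s @ t\<close> (\<open>bump_plactic\<close>).

  For two consecutive rows, the column conditions are preserved by insertion
  (\<open>bump_preserves_below\<close>) and by its inverse (\<open>bump_reflects_below\<close>), because a letter bumped from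
  some column is inserted in the next row in the same column or further left. Moreover the new second
  row is not longer than the old first row. Over all rows this says that the old shape and the new one
  interlace, which is what a horizontal strip means.
\<close>

section \<open>Row and column relations on letters\<close>

text \<open>\<open>row_le a b\<close>: \<open>a\<close> may stand immediately to the left of \<open>b\<close> in a row.\<close>

definition row_le :: "'a::signed_alphabet \<Rightarrow> 'a \<Rightarrow> bool" where
  "row_le a b \<longleftrightarrow> a \<le> b \<and> (a = b \<longrightarrow> parity a = 0)"

text \<open>\<open>col_le a b\<close>: \<open>a\<close> may stand immediately above \<open>b\<close> in a column.\<close>

definition col_le :: "'a::signed_alphabet \<Rightarrow> 'a \<Rightarrow> bool" where
  "col_le a b \<longleftrightarrow> a \<le> b \<and> (a = b \<longrightarrow> parity a = 1)"

lemma not_row_le_iff: "\<not> row_le a b \<longleftrightarrow> col_le b a"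
  by (cases "parity a") (auto simp: row_le_def col_le_def)

lemma not_col_le_iff: "\<not> col_le a b \<longleftrightarrow> row_le b a"
  using not_row_le_iff by blast

lemma row_le_trans: "row_le a b \<Longrightarrow> row_le b c \<Longrightarrow> row_le a c"
  by (force simp: row_le_def)

lemma col_le_trans: "col_le a b \<Longrightarrow> col_le b c \<Longrightarrow> col_le a c"
  by (force simp: col_le_def)

lemma row_col_less: "row_le a b \<Longrightarrow> col_le b c \<Longrightarrow> a < c"
  by (auto simp: row_le_def col_le_def le_less)

lemma col_row_less: "col_le a b \<Longrightarrow> row_le b c \<Longrightarrow> a < c"
  by (auto simp: row_le_def col_le_def le_less)

lemma less_imp_row_le: "a < b \<Longrightarrow> row_le a b"
  by (auto simp: row_le_def)

lemma less_imp_col_le: "a < b \<Longrightarrow> col_le a b"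
  by (auto simp: col_le_def)

text \<open>If two letters are related by a row step and a column step, in either order, then they
  are related in both ways.\<close>

lemmas row_col_mixed = row_col_less[THEN less_imp_row_le] row_col_less[THEN less_imp_col_le]
  col_row_less[THEN less_imp_row_le] col_row_less[THEN less_imp_col_le]

section \<open>Rows and pairs of adjacent rows\<close>

abbreviation is_row :: "'a::signed_alphabet list \<Rightarrow> bool" where
  "is_row \<equiv> sorted_wrt row_le"

text \<open>\<open>below xs q\<close>: the row \<open>xs\<close> may be placed, left-aligned, directly under \<open>q\<close>. In particular
  \<open>xs\<close> is not longer than \<open>q\<close>.\<close>

fun below :: "'a::signed_alphabet list \<Rightarrow> 'a list \<Rightarrow> bool" where
  "below [] q \<longleftrightarrow> True"
| "below (x # xs) [] \<longleftrightarrow> False"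
| "below (x # xs) (y # q) \<longleftrightarrow> col_le y x \<and> below xs q"

lemma below_iff_nth:
  "below xs q \<longleftrightarrow> length xs \<le> length q \<and> (\<forall>i<length xs. col_le (q ! i) (xs ! i))"
  by (induction xs q rule: below.induct) (auto simp: less_Suc_eq_0_disj)

lemma below_length: "below xs q \<Longrightarrow> length xs \<le> length q"
  by (simp add: below_iff_nth)

lemma below_append: "below xs q \<Longrightarrow> below xs (q @ t)"
  by (auto simp: below_iff_nth nth_append)

lemma below_appendD: "below xs (q @ t) \<Longrightarrow> length xs \<le> length q \<Longrightarrow> below xs q"
  by (auto simp: below_iff_nth nth_append)

lemma below_prefix: "below (xs @ ys) q \<Longrightarrow> below xs q"
  by (induction xs q rule: below.induct) auto

lemma below_Cons_right: "below xs q \<Longrightarrow> is_row (y # q) \<Longrightarrow> below xs (y # q)"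
  by (induction xs q arbitrary: y rule: below.induct) (auto intro: row_col_mixed)

lemma below_tl: "below (x # xs) q \<Longrightarrow> is_row q \<Longrightarrow> below xs q"
  by (cases q) (auto intro: below_Cons_right)

lemma below_drop: "below xs q \<Longrightarrow> is_row q \<Longrightarrow> below (drop d xs) q"
  by (induction d arbitrary: xs) (auto simp: drop_Suc, metis below_tl list.exhaust list.sel(2,3))

lemma below_subseq:
  assumes "subseq xs ys" "below ys q" "is_row q"
  shows "below xs q"
  using assms
proof (induction arbitrary: q rule: list_emb.induct)
  case (list_emb_Cons xs ys y)
  then show ?case using below_tl by blast
next
  case (list_emb_Cons2 x y xs ys)
  then show ?case by (cases q) auto
qed auto

section \<open>Inserting a row word in a row\<close>

text \<open>\<open>bump r w s e t\<close>: inserting the letters of \<open>w\<close>, from left to right, in the row \<open>r\<close> turns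
  \<open>r\<close> into \<open>s @ t\<close> and bumps the letters \<open>e\<close>. Here \<open>s\<close> has the length of \<open>r\<close>, and \<open>t\<close> is the
  part of \<open>w\<close> that is appended at the end. When \<open>r\<close> and \<open>w\<close> are rows, the insertions take place
  at increasing positions, so one scan of \<open>r\<close> suffices.\<close>

inductive bump ::
  "'a::signed_alphabet list \<Rightarrow> 'a list \<Rightarrow> 'a list \<Rightarrow> 'a list \<Rightarrow> 'a list \<Rightarrow> bool" where
  bump_Nil: "bump [] w [] [] w"
| bump_keep: "\<lbrakk>w \<noteq> [] \<longrightarrow> row_le a (hd w); bump r w s e t\<rbrakk> \<Longrightarrow> bump (a # r) w (a # s) e t"
| bump_replace: "\<lbrakk>col_le x a; bump r w s e t\<rbrakk> \<Longrightarrow> bump (a # r) (x # w) (x # s) (a # e) t"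

lemma bump_Nil_iff: "bump [] w s e t \<longleftrightarrow> s = [] \<and> e = [] \<and> t = w"
  by (auto elim: bump.cases intro: bump.intros)

lemma bump_Cons_iff: "bump (a # r) w s e t \<longleftrightarrow>
    (\<exists>s'. s = a # s' \<and> (w \<noteq> [] \<longrightarrow> row_le a (hd w)) \<and> bump r w s' e t) \<or>
    (\<exists>x w' s' e'. w = x # w' \<and> s = x # s' \<and> e = a # e' \<and> col_le x a \<and> bump r w' s' e' t)"
  by (subst bump.simps) auto

lemma bump_append:
  "bump r w s1 e1 t1 \<Longrightarrow> bump r' t1 s2 e2 t \<Longrightarrow> bump (r @ r') w (s1 @ s2) (e1 @ e2) t"
  by (induction rule: bump.induct) (auto intro: bump.intros)

lemma bump_appendE:
  assumes "bump (r @ r') w s e t"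
  obtains s1 e1 t1 s2 e2 where "bump r w s1 e1 t1" "bump r' t1 s2 e2 t" "s = s1 @ s2" "e = e1 @ e2"
  using assms
proof (induction r arbitrary: w s e thesis)
  case Nil
  then show ?case by (force intro: bump_Nil)
next
  case (Cons a r)
  from Cons.prems(2)[unfolded append_Cons bump_Cons_iff] show ?case
  proof (elim disjE exE conjE)
    fix s' assume *: "s = a # s'" "w \<noteq> [] \<longrightarrow> row_le a (hd w)" "bump (r @ r') w s' e t"
    obtain s1 e1 t1 s2 e2 where
      **: "bump r w s1 e1 t1" "bump r' t1 s2 e2 t" "s' = s1 @ s2" "e = e1 @ e2"
      using Cons.IH[OF _ *(3)] by blast
    show ?thesis
      by (rule Cons.prems(1)[OF bump_keep[OF *(2) **(1)] **(2)]) (simp_all add: * **)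
  next
    fix x w' s' e'
    assume *: "w = x # w'" "s = x # s'" "e = a # e'" "col_le x a" "bump (r @ r') w' s' e' t"
    obtain s1 e1 t1 s2 e2 where
      **: "bump r w' s1 e1 t1" "bump r' t1 s2 e2 t" "s' = s1 @ s2" "e' = e1 @ e2"
      using Cons.IH[OF _ *(5)] by blast
    show ?thesis
      by (rule Cons.prems(1)[OF bump_replace[OF *(4) **(1), folded *(1)] **(2)]) (simp_all add: * **)
  qed
qed

lemma bump_exists: "\<exists>s e t. bump r w s e t"
proof (induction r arbitrary: w)
  case Nil
  then show ?case by (simp add: bump_Nil_iff)
next
  case (Cons a r)
  show ?case
  proof (cases "w \<noteq> [] \<longrightarrow> row_le a (hd w)")
    case True
    from Cons.IH obtain s e t where "bump r w s e t" by blast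
    from bump_keep[OF True this] show ?thesis by blast
  next
    case False
    then obtain x w' where w: "w = x # w'" "col_le x a"
      by (cases w) (auto simp: not_row_le_iff)
    from Cons.IH obtain s e t where "bump r w' s e t" by blast
    from bump_replace[OF w(2) this] show ?thesis unfolding w(1) by blast
  qed
qed

lemma bump_functional:
  "bump r w s e t \<Longrightarrow> bump r w s' e' t' \<Longrightarrow> s' = s \<and> e' = e \<and> t' = t"
proof (induction arbitrary: s' e' t' rule: bump.induct)
  case (bump_keep w a r s e t)
  note IH = bump_keep.IH and keep = bump_keep.hyps(1)
  from bump_keep.prems show ?case
  proof (cases rule: bump.cases)
    case bump_keep
    then show ?thesis using IH by auto
  next
    case (bump_replace x)
    then show ?thesis using keep not_row_le_iff[of a x] by auto
  qed
next
  case (bump_replace x a r w s e t)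
  note IH = bump_replace.IH and repl = bump_replace.hyps(1)
  from bump_replace.prems show ?case
  proof (cases rule: bump.cases)
    case bump_keep
    then show ?thesis using repl not_row_le_iff[of a x] by auto
  next
    case bump_replace
    then show ?thesis using IH by auto
  qed
qed (auto simp: bump_Nil_iff)

lemma bump_length: "bump r w s e t \<Longrightarrow> length s = length r \<and> length w = length e + length t"
  by (induction rule: bump.induct) auto

lemma bump_set:
  "bump r w s e t \<Longrightarrow> set e \<subseteq> set r \<and> set r \<subseteq> set s \<union> set e \<and>
     set w \<subseteq> set (s @ t) \<and> set (s @ t) \<subseteq> set r \<union> set w"
  by (induction rule: bump.induct) auto

lemma bump_subseq: "bump r w s e t \<Longrightarrow> subseq w (s @ t) \<and> subseq e r"
  by (induction rule: bump.induct) auto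

text \<open>The output \<open>(e, s @ t)\<close> is a tableau with two rows; the bound on the length of \<open>e\<close> by that
  of \<open>s\<close> (not only of \<open>s @ t\<close>) is part of \<open>below e s\<close>.\<close>

lemma bump_rows:
  assumes "bump r w s e t" "is_row r" "is_row w"
  shows "is_row (s @ t) \<and> is_row e \<and> below e s"
  using assms
proof (induction rule: bump.induct)
  case (bump_keep w a r s e t)
  then have IH: "is_row (s @ t)" "is_row e" "below e s" by auto
  have "row_le a b" if "b \<in> set w" for b
    using that bump_keep.hyps(1) bump_keep.prems(2) by (cases w) (auto intro: row_le_trans)
  then have "is_row (a # s @ t)"
    using IH bump_keep.prems bump_set[OF bump_keep.hyps(2)] by auto
  moreover from this have "below e (a # s)"
    using IH(3) by (intro below_Cons_right) (auto simp: sorted_wrt_append)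
  ultimately show ?case using IH by auto
next
  case (bump_replace x a r w s e t)
  then have IH: "is_row (s @ t)" "is_row e" "below e s" by auto
  have "row_le x b" if "b \<in> set r" for b
    using that bump_replace.hyps(1) bump_replace.prems(1) by (auto intro: row_col_mixed)
  then have "is_row (x # s @ t)"
    using IH bump_replace.prems bump_set[OF bump_replace.hyps(2)] by auto
  moreover have "is_row (a # e)"
    using IH bump_replace.prems bump_set[OF bump_replace.hyps(2)] by auto
  ultimately show ?case using IH bump_replace.hyps(1) by auto
qed auto

text \<open>The last step of the scan. It is the basis for undoing an insertion from right to left.\<close>

lemma bump_snoc_iff: "bump (r @ [a]) w s e t \<longleftrightarrow>
    (\<exists>s'. s = s' @ [a] \<and> (t \<noteq> [] \<longrightarrow> row_le a (hd t)) \<and> bump r w s' e t) \<or>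
    (\<exists>x s' e'. s = s' @ [x] \<and> e = e' @ [a] \<and> col_le x a \<and> bump r w s' e' (x # t))"
  (is "?l \<longleftrightarrow> ?r")
proof
  assume ?l
  then obtain s1 e1 t1 s2 e2
    where *: "bump r w s1 e1 t1" "bump [a] t1 s2 e2 t" "s = s1 @ s2" "e = e1 @ e2"
    by (rule bump_appendE)
  from *(2) consider "s2 = [a]" "e2 = []" "t1 = t" "t \<noteq> [] \<longrightarrow> row_le a (hd t)"
    | x where "t1 = x # t" "s2 = [x]" "e2 = [a]" "col_le x a"
    by (auto simp: bump_Cons_iff bump_Nil_iff)
  then show ?r using * by cases auto
next
  assume ?r
  then show ?l
  proof (elim disjE exE conjE)
    fix s' assume *: "s = s' @ [a]" "t \<noteq> [] \<longrightarrow> row_le a (hd t)" "bump r w s' e t"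
    have "bump [a] t [a] [] t" using *(2) by (auto simp: bump_Cons_iff bump_Nil_iff)
    from bump_append[OF *(3) this] show ?l using * by simp
  next
    fix x s' e' assume *: "s = s' @ [x]" "e = e' @ [a]" "col_le x a" "bump r w s' e' (x # t)"
    have "bump [a] (x # t) [x] [a] t" using *(3) by (auto simp: bump_Cons_iff bump_Nil_iff)
    from bump_append[OF *(4) this] show ?l using * by simp
  qed
qed

lemma bump_injective:
  assumes "bump r w s e t" "bump r' w' s e t" "is_row r" "is_row r'"
  shows "r' = r \<and> w' = w"
  using assms
proof (induction r arbitrary: w s e t r' rule: rev_induct)
  case Nil
  then show ?case using bump_length[OF Nil(2)] by (auto simp: bump_Nil_iff)
next
  case (snoc a r)
  have "length r' = Suc (length r)"
    using bump_length[OF snoc.prems(1)] bump_length[OF snoc.prems(2)] by simp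
  then obtain q b where r': "r' = q @ [b]" by (metis length_Suc_conv_rev)
  have rows: "is_row r" "is_row q" "\<And>c. c \<in> set r \<Longrightarrow> row_le c a" "\<And>c. c \<in> set q \<Longrightarrow> row_le c b"
    using snoc.prems r' by (auto simp: sorted_wrt_append)
  \<comment> \<open>The two cases of the last step exclude each other: a bumped letter comes from the old row.\<close>
  have clash: False if "bump p v s1 (e1 @ [y]) t1" "col_le z y" "\<And>c. c \<in> set p \<Longrightarrow> row_le c z"
    for p v s1 e1 y t1 and z :: 'a
  proof -
    have "y \<in> set p" using bump_set[OF that(1)] by auto
    then show False using that(2,3) not_row_le_iff by blast
  qed
  from snoc.prems(1)[unfolded bump_snoc_iff] show ?case
  proof (elim disjE exE conjE)
    fix s1 assume 1: "s = s1 @ [a]" "bump r w s1 e t"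
    from snoc.prems(2)[unfolded r' bump_snoc_iff] show ?case
    proof (elim disjE exE conjE)
      fix s2 assume "s = s2 @ [b]" "bump q w' s2 e t"
      then show ?case using snoc.IH[OF 1(2) _ rows(1,2)] 1 r' by auto
    next
      fix x s2 e2 assume "s = s2 @ [x]" "e = e2 @ [b]" "col_le x b"
      then show ?case using clash[of r w s1 e2 b t a] 1 rows(3) by auto
    qed
  next
    fix x s1 e1 assume 1: "s = s1 @ [x]" "e = e1 @ [a]" "col_le x a" "bump r w s1 e1 (x # t)"
    from snoc.prems(2)[unfolded r' bump_snoc_iff] show ?case
    proof (elim disjE exE conjE)
      fix s2 assume "s = s2 @ [b]" "bump q w' s2 e t"
      then show ?case using clash[of q w' s2 e1 a t b] 1 rows(4) by auto
    next
      fix y s2 e2 assume "s = s2 @ [y]" "e = e2 @ [b]" "bump q w' s2 e2 (y # t)"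
      then show ?case using snoc.IH[OF 1(4) _ rows(1,2)] 1 r' by auto
    qed
  qed
qed

lemma bump_surjective:
  assumes "is_row (s @ t)" "is_row e" "below e s"
  shows "\<exists>r w. is_row r \<and> is_row w \<and> bump r w s e t"
  using assms
proof (induction s arbitrary: e t rule: rev_induct)
  case Nil
  then have "e = []" by (cases e) auto
  with Nil show ?case
    by (intro exI[where P = "\<lambda>r. \<exists>w. is_row r \<and> _ r w", of "[]"] exI[of _ t]) (simp add: bump_Nil_iff)
next
  case (snoc z s)
  \<comment> \<open>If \<open>z\<close> can stand above the last bumped letter, it was inserted there; otherwise \<open>z\<close> was kept.\<close>
  have rows: "is_row (s @ z # t)" "is_row (s @ t)"
    using snoc.prems by (auto simp: sorted_wrt_append)
  have sz: "row_le c z" if "c \<in> set s" for c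
    using that rows by (auto simp: sorted_wrt_append)
  show ?case
  proof (cases "e \<noteq> [] \<and> col_le z (last e)")
    case True
    then obtain e' a where e: "e = e' @ [a]" and za: "col_le z a"
      by (cases e rule: rev_cases) auto
    have "below e' s"
      using below_length[OF snoc.prems(3)] below_prefix[OF snoc.prems(3)[unfolded e]]
      by (intro below_appendD[of e' s "[z]"]) (simp_all add: e)
    moreover have ea: "is_row e'" "\<And>c. c \<in> set e' \<Longrightarrow> row_le c a"
      using snoc.prems(2) e by (auto simp: sorted_wrt_append)
    ultimately obtain r w where rw: "is_row r" "is_row w" "bump r w s e' (z # t)"
      using snoc.IH[OF rows(1)] by blast
    have "row_le c a" if "c \<in> set r" for c
      using that bump_set[OF rw(3)] ea(2)[of c] row_col_mixed(1)[OF sz za] by blast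
    then have "is_row (r @ [a])" using rw by (auto simp: sorted_wrt_append)
    moreover have "bump (r @ [a]) w (s @ [z]) e t"
      unfolding bump_snoc_iff using rw e za by auto
    ultimately show ?thesis using rw by blast
  next
    case False
    then have ez: "row_le c z" if "c \<in> set e" for c
      using that snoc.prems(2)
      by (cases e rule: rev_cases) (auto simp: sorted_wrt_append not_col_le_iff intro: row_le_trans)
    \<comment> \<open>If \<open>e\<close> were as long as \<open>s @ [z]\<close>, its last letter would stand under \<open>z\<close>.\<close>
    have "length e \<noteq> Suc (length s)"
    proof
      assume *: "length e = Suc (length s)"
      then have "e \<noteq> []" by auto
      then have "last e = e ! length s" using * by (simp add: last_conv_nth)
      then show False
        using False snoc.prems(3) * \<open>e \<noteq> []\<close> by (auto simp: below_iff_nth nth_append)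
    qed
    then have "below e s"
      using below_length[OF snoc.prems(3)] by (intro below_appendD[OF snoc.prems(3)]) auto
    then obtain r w where rw: "is_row r" "is_row w" "bump r w s e t"
      using snoc.IH[OF rows(2) snoc.prems(2)] by blast
    have "row_le c z" if "c \<in> set r" for c
      using that bump_set[OF rw(3)] sz[of c] ez[of c] by blast
    then have "is_row (r @ [z])" using rw by (auto simp: sorted_wrt_append)
    moreover have "bump (r @ [z]) w (s @ [z]) e t"
      unfolding bump_snoc_iff using rw rows(1) by (cases t) (auto simp: sorted_wrt_append)
    ultimately show ?thesis using rw by blast
  qed
qed

section \<open>Insertion in two consecutive rows\<close>

text \<open>Only the case \<open>d = 0\<close> is used later. In the induction on the columns, \<open>d\<close> is the number of
  letters by which the lower row is ahead: those already inserted in it although the scan of the upper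
  row has not bumped them yet. That \<open>d\<close> never becomes negative means that every letter is inserted
  weakly to the left of the column from which it is bumped.\<close>

lemma bump_preserves_below:
  assumes "bump r w s e t" "bump r2 (drop d e) s2 e2 t2"
    and "is_row r" "is_row w" "is_row r2" "below r2 r"
  shows "below (s2 @ t2) s"
  using assms
proof (induction arbitrary: r2 d s2 e2 rule: bump.induct)
  case (bump_Nil w)
  then show ?case by (cases r2) (auto simp: bump_Nil_iff)
next
  case (bump_keep w a r s e t)
  have rows: "is_row (a # s)" "below e (a # s)"
    using bump_rows[OF bump.bump_keep[OF bump_keep.hyps] bump_keep.prems(2,3)]
    by (auto simp: sorted_wrt_append)
  show ?case
  proof (cases r2)
    case Nil
    then show ?thesis
      using bump_keep.prems(1) below_drop[OF rows(2,1), of d] by (simp add: bump_Nil_iff)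
  next
    case (Cons b q)
    have ab: "col_le a b" "below q r" and q: "is_row q" and r: "is_row r"
      using bump_keep.prems Cons by auto
    from bump_keep.prems(1)[unfolded Cons bump_Cons_iff] show ?thesis
    proof (elim disjE exE conjE)
      fix s' assume "s2 = b # s'" "bump q (drop d e) s' e2 t2"
      then show ?thesis using bump_keep.IH[of q d s' e2] r bump_keep.prems(3) q ab by simp
    next
      fix h w' s' e' assume h: "drop d e = h # w'" "s2 = h # s'" "bump q w' s' e' t2"
      have w': "w' = drop (Suc d) e" using arg_cong[OF h(1), of tl] by (simp add: drop_Suc tl_drop)
      have "below (drop d e) (a # s)" using below_drop[OF rows(2,1)] .
      then show ?thesis
        using bump_keep.IH[OF h(3)[unfolded w'] r bump_keep.prems(3) q ab(2)] h by simp
    qed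
  qed
next
  case (bump_replace x a r w s e t)
  have rows: "is_row (x # s)" "below (a # e) (x # s)"
    using bump_rows[OF bump.bump_replace[OF bump_replace.hyps] bump_replace.prems(2,3)]
    by (auto simp: sorted_wrt_append)
  show ?case
  proof (cases r2)
    case Nil
    then show ?thesis
      using bump_replace.prems(1) below_drop[OF rows(2,1), of d] by (simp add: bump_Nil_iff)
  next
    case (Cons b q)
    have ab: "col_le a b" "below q r" and q: "is_row q" and r: "is_row r" and w: "is_row w"
      using bump_replace.prems Cons by auto
    note IH = bump_replace.IH[OF _ r w q ab(2)]
    from bump_replace.prems(1)[unfolded Cons bump_Cons_iff] show ?thesis
    proof (elim disjE exE conjE)
      fix s' assume s': "s2 = b # s'" "bump q (drop d (a # e)) s' e2 t2"
        "drop d (a # e) \<noteq> [] \<longrightarrow> row_le b (hd (drop d (a # e)))"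
      \<comment> \<open>For \<open>d = 0\<close> the lower row would insert \<open>a\<close> here, as \<open>a\<close> stands above \<open>b\<close>.\<close>
      then obtain d' where "d = Suc d'" using ab(1) not_row_le_iff[of b a] by (cases d) auto
      then show ?thesis
        using IH[of d' s' e2] s' col_le_trans[OF bump_replace.hyps(1) ab(1)] by simp
    next
      fix h w' s' e' assume h: "drop d (a # e) = h # w'" "s2 = h # s'" "bump q w' s' e' t2"
      have w': "w' = drop d e" using arg_cong[OF h(1), of tl] by (simp add: drop_Suc tl_drop)
      have "below (drop d (a # e)) (x # s)" using below_drop[OF rows(2,1)] .
      then show ?thesis using IH[OF h(3)[unfolded w']] h by simp
    qed
  qed
qed

text \<open>The converse, by induction on the columns that remain to the right. The word of all letters that
  pass from the upper row to the lower one is \<open>g @ e = g' @ e'\<close>: in the columns already scanned, \<open>g\<close>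
  has been bumped from the upper row and \<open>g'\<close> has been inserted in the lower one. The first part of
  the conclusion says that the lower row is not behind the upper one.\<close>

lemma bump_reflects_below_aux:
  assumes "bump r w s e t" "bump r2 e' s2 e2 t2" "g @ e = g' @ e'"
    and "\<forall>y\<in>set g. \<forall>a\<in>set r. row_le y a" "\<forall>y\<in>set g'. \<forall>b\<in>set r2. col_le y b"
    and "is_row r" "is_row r2" "below (s2 @ t2) s"
  shows "length e' \<le> length e \<and> below r2 r"
  using assms
proof (induction arbitrary: r2 e' s2 e2 g g' t2 rule: bump.induct)
  case (bump_Nil w)
  then have "s2 = []" "t2 = []" by (auto elim: below.elims)
  then show ?case using bump_length[OF bump_Nil.prems(1)] bump_Nil.prems(1)
    by (cases r2) (auto simp: bump_Nil_iff)
next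
  case (bump_keep w a r s e t)
  note prems = bump_keep.prems
  \<comment> \<open>If the lower row were behind, the letter \<open>y\<close> inserted under the unchanged letter \<open>a\<close> would
    have been bumped further to the left, so that \<open>y\<close> could stand before \<open>a\<close>, not below it.\<close>
  have bound: "length (y # e1) \<le> length e"
    if "length e1 \<le> length e" "g @ e = g' @ y # e1" "col_le a y" for y e1
  proof (rule ccontr)
    assume "\<not> ?thesis"
    with that(1) have len: "length e = length e1" by simp
    have "g @ e = (g' @ [y]) @ e1" using that(2) by simp
    then have "g = g' @ [y]" using len append_eq_append_conv by blast
    then have "row_le y a" using prems(3) by auto
    with that(3) show False using not_row_le_iff by blast
  qed
  have g: "\<forall>y\<in>set g. \<forall>a\<in>set r. row_le y a" and r: "is_row r" using prems by auto
  show ?case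
  proof (cases r2)
    case Nil
    then have [simp]: "s2 = []" "t2 = e'" using prems(1) by (auto simp: bump_Nil_iff)
    show ?thesis
    proof (cases e')
      case (Cons y e1)
      have "length e1 \<le> length e"
        using bump_keep.IH[of "[]" e1 "[]" "[]" e1 g "g' @ [y]"] prems Cons g r
        by (auto simp: bump_Nil_iff)
      then show ?thesis using bound[of e1 y] Cons prems Nil by auto
    qed (simp add: Nil)
  next
    case (Cons b q)
    from prems(1)[unfolded Cons bump_Cons_iff] show ?thesis
    proof (elim disjE exE conjE)
      fix s' assume *: "s2 = b # s'" "bump q e' s' e2 t2"
      have "length e' \<le> length e \<and> below q r"
        using bump_keep.IH[OF *(2) prems(2) g _ r] prems * Cons by auto
      then show ?thesis using prems * Cons by auto
    next
      fix y w' s' e1 assume *: "e' = y # w'" "s2 = y # s'" "col_le y b" "bump q w' s' e1 t2"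
      have "\<forall>z\<in>set (g' @ [y]). \<forall>b\<in>set q. col_le z b"
        using prems(4,6) Cons *(3) by (auto intro: row_col_mixed)
      then have IH: "length w' \<le> length e \<and> below q r"
        using bump_keep.IH[OF *(4), of g "g' @ [y]"] prems * Cons g r by auto
      moreover have ay: "col_le a y" using prems * by auto
      ultimately show ?thesis
        using bound[of w' y] prems(2) col_le_trans[OF ay *(3)] * Cons by auto
    qed
  qed
next
  case (bump_replace x a r w s e t)
  note prems = bump_replace.prems
  have g: "\<forall>y\<in>set (g @ [a]). \<forall>a\<in>set r. row_le y a" and r: "is_row r" using prems by auto
  have re: "row_le a c" if "c \<in> set e" for c
    using that prems(5) bump_set[OF bump_replace.hyps(2)] by auto
  show ?case
  proof (cases r2)
    case Nil
    then have [simp]: "s2 = []" "t2 = e'" using prems(1) by (auto simp: bump_Nil_iff)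
    show ?thesis
    proof (cases e')
      case (Cons y e1)
      have "length e1 \<le> length e"
        using bump_replace.IH[of "[]" e1 "[]" "[]" e1 "g @ [a]" "g' @ [y]"] prems Cons g r
        by (auto simp: bump_Nil_iff)
      then show ?thesis using Cons Nil by auto
    qed (simp add: Nil)
  next
    case (Cons b q)
    from prems(1)[unfolded Cons bump_Cons_iff] show ?thesis
    proof (elim disjE exE conjE)
      fix s' assume *: "s2 = b # s'" "bump q e' s' e2 t2"
      have IH: "length e' \<le> length e \<and> below q r"
        using bump_replace.IH[OF *(2), of "g @ [a]" g'] prems * Cons g r by auto
      \<comment> \<open>The letter \<open>a\<close> has been inserted in the lower row in an earlier column.\<close>
      obtain f where "g' = g @ a # f"
        using prems(2) IH by (auto simp: append_eq_append_conv2 Cons_eq_append_conv)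
      then have "col_le a b" using prems(4) Cons by auto
      then show ?thesis using IH Cons by auto
    next
      fix y w' s' e1 assume *: "e' = y # w'" "s2 = y # s'" "col_le y b" "bump q w' s' e1 t2"
      have "\<forall>z\<in>set (g' @ [y]). \<forall>b\<in>set q. col_le z b"
        using prems(4,6) Cons *(3) by (auto intro: row_col_mixed)
      then have IH: "length w' \<le> length e \<and> below q r"
        using bump_replace.IH[OF *(4), of "g @ [a]" "g' @ [y]"] prems * Cons g r by auto
      \<comment> \<open>The letter \<open>y\<close> is bumped from the column of \<open>a\<close> or from a later one.\<close>
      have "suffix (a # e) (g @ a # e)" by (simp add: suffix_def)
      moreover have "suffix (y # w') (g @ a # e)"
        unfolding suffix_def using prems(2) *(1) by auto
      ultimately have "suffix (y # w') (a # e)"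
        using IH by (auto intro: suffix_length_suffix)
      then have "y \<in> insert a (set e)" using set_mono_suffix by fastforce
      then have "col_le a b" using *(3) re by (auto intro: row_col_mixed)
      then show ?thesis using IH * Cons by auto
    qed
  qed
qed

lemma bump_reflects_below:
  assumes "bump r w s e t" "bump r2 e s2 e2 t2" "is_row r" "is_row r2" "below (s2 @ t2) s"
  shows "below r2 r"
  using bump_reflects_below_aux[OF assms(1,2), of "[]" "[]"] assms by simp

section \<open>Insertion in a row and the plactic relations\<close>

lemma plactic_Cons: "plactic_equiv u v \<Longrightarrow> plactic_equiv (x # u) (x # v)"
  using plactic_append[OF plactic_refl[of "[x]"]] by auto

lemma plactic_append_right: "plactic_equiv u v \<Longrightarrow> plactic_equiv (u @ w) (v @ w)"
  by (rule plactic_append[OF _ plactic_refl])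

lemma plactic_append_left: "plactic_equiv u v \<Longrightarrow> plactic_equiv (w @ u) (w @ v)"
  by (rule plactic_append[OF plactic_refl])

lemma plactic_K1: "row_le x y \<Longrightarrow> col_le y z \<Longrightarrow> plactic_equiv (x # z # y # w) (z # x # y # w)"
  using plactic_append_right[OF K1, of x y z w] by (auto simp: row_le_def col_le_def)

lemma plactic_K2: "col_le x y \<Longrightarrow> row_le y z \<Longrightarrow> plactic_equiv (y # z # x # w) (y # x # z # w)"
  using plactic_append_right[OF plactic_sym[OF K2], of x y z w] by (auto simp: row_le_def col_le_def)

text \<open>Inserting one letter \<open>x\<close> in a row \<open>u @ y # v\<close>, where \<open>y\<close> is bumped: \<open>x\<close> moves to the left
  through \<open>v\<close> by (K2), and then \<open>y\<close> moves out through \<open>u\<close> by (K1).\<close>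

lemma plactic_move_left:
  "is_row (y # v) \<Longrightarrow> col_le x y \<Longrightarrow> plactic_equiv (y # v @ [x]) (y # x # v)"
proof (induction v arbitrary: y)
  case (Cons z v)
  then have "plactic_equiv (z # v @ [x]) (z # x # v)" by (auto intro: row_col_mixed)
  then have "plactic_equiv (y # z # v @ [x]) (y # z # x # v)" by (rule plactic_Cons)
  moreover have "plactic_equiv (y # z # x # v) (y # x # z # v)"
    using Cons.prems by (auto intro: plactic_K2)
  ultimately show ?case by (auto intro: plactic_trans)
qed (auto intro: plactic_refl)

lemma plactic_move_out:
  "is_row (u @ [x]) \<Longrightarrow> col_le x y \<Longrightarrow> plactic_equiv (u @ y # x # v) (y # u @ x # v)"
proof (induction u)
  case (Cons a u)
  obtain c q where c: "u @ x # v = c # q" "c \<in> set u \<union> {x}"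
    by (cases u) auto
  have "row_le a c" "col_le c y"
    using Cons.prems c by (auto simp: sorted_wrt_append intro: row_col_mixed)
  then have "plactic_equiv (a # y # u @ x # v) (y # a # u @ x # v)"
    unfolding c(1) by (rule plactic_K1)
  moreover have "plactic_equiv (a # u @ y # x # v) (a # y # u @ x # v)"
    using Cons by (intro plactic_Cons) auto
  ultimately show ?case by (auto intro: plactic_trans)
qed (auto intro: plactic_refl)

text \<open>The scan inserts the letters of \<open>w\<close> one after the other: splitting off the first letter.\<close>

lemma bump_first_letter:
  assumes "bump r (x # w) s e t" "is_row r" "is_row (x # w)"
  shows "e = [] \<and> s = r \<and> t = x # w \<or>
    (\<exists>u y v e'. r = u @ y # v \<and> e = y # e' \<and> (\<forall>a\<in>set u. row_le a x) \<and> col_le x y \<and>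
       bump (u @ x # v) w s e' t)"
  using assms
proof (induction r arbitrary: s e)
  case Nil
  then show ?case by (auto simp: bump_Nil_iff)
next
  case (Cons a r)
  from Cons.prems(1)[unfolded bump_Cons_iff] show ?case
  proof (elim disjE exE conjE)
    fix s' assume *: "s = a # s'" "x # w \<noteq> [] \<longrightarrow> row_le a (hd (x # w))" "bump r (x # w) s' e t"
    have aw: "w \<noteq> [] \<longrightarrow> row_le a (hd w)"
      using *(2) Cons.prems(3) row_le_trans[of a x] by (cases w) auto
    have "is_row r" using Cons.prems(2) by simp
    from Cons.IH[OF *(3) this Cons.prems(3)] show ?thesis
    proof (elim disjE exE conjE)
      fix u y v e'
      assume "r = u @ y # v" "e = y # e'" "\<forall>a\<in>set u. row_le a x" "col_le x y"
        "bump (u @ x # v) w s' e' t"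
      then show ?thesis
        using * aw bump_keep[OF aw] by (intro disjI2 exI[of _ "a # u"]) auto
    qed (use * in auto)
  next
    fix x' w' s' e' assume "x # w = x' # w'" "s = x' # s'" "e = a # e'" "col_le x' a" "bump r w' s' e' t"
    moreover have "w \<noteq> [] \<longrightarrow> row_le x (hd w)" using Cons.prems(3) by (cases w) auto
    ultimately show ?thesis
      by (intro disjI2 exI[of _ "[]"]) (auto intro: bump_keep)
  qed
qed

lemma bump_plactic:
  assumes "bump r w s e t" "is_row r" "is_row w"
  shows "plactic_equiv (r @ w) (e @ s @ t)"
  using assms
proof (induction w arbitrary: r e)
  case Nil
  have "s = r \<and> e = [] \<and> t = []"
    using Nil(1) by (induction r arbitrary: s) (auto simp: bump_Nil_iff bump_Cons_iff)
  then show ?case by (simp add: plactic_refl)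
next
  case (Cons x w)
  from bump_first_letter[OF Cons.prems] show ?case
  proof (elim disjE exE conjE)
    fix u y v e'
    assume *: "r = u @ y # v" "e = y # e'" "\<forall>a\<in>set u. row_le a x" "col_le x y"
        "bump (u @ x # v) w s e' t"
    have "is_row (u @ x # v)"
      using Cons.prems(2) * by (auto simp: sorted_wrt_append intro: row_col_mixed)
    then have "plactic_equiv ((u @ x # v) @ w) (e' @ s @ t)"
      using Cons.IH[OF *(5)] Cons.prems by auto
    then have "plactic_equiv (y # u @ x # v @ w) (e @ s @ t)"
      using plactic_Cons * by fastforce
    moreover have "plactic_equiv (u @ y # v @ [x]) (u @ y # x # v)"
      using Cons.prems * by (intro plactic_append_left plactic_move_left) (auto simp: sorted_wrt_append)
    moreover have "plactic_equiv (u @ y # x # v) (y # u @ x # v)"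
      using Cons.prems * by (intro plactic_move_out) (auto simp: sorted_wrt_append)
    ultimately show ?thesis
      using plactic_append_right[of "u @ y # v @ [x]" "y # u @ x # v" w] *(1)
      by (auto intro: plactic_trans)
  qed (auto intro: plactic_refl)
qed

section \<open>Inserting a row word in a tableau\<close>

text \<open>The first row, or the empty row for the empty tableau.\<close>

definition first_row :: "'a list list \<Rightarrow> 'a list" where
  "first_row T = (case T of [] \<Rightarrow> [] | r # _ \<Rightarrow> r)"

lemma first_row_simps [simp]: "first_row [] = []" "first_row (r # T) = r"
  by (simp_all add: first_row_def)

text \<open>Tableaux as lists of nonempty rows, from top to bottom.\<close>

fun is_tableau :: "'a::signed_alphabet list list \<Rightarrow> bool" where
  "is_tableau [] \<longleftrightarrow> True"
| "is_tableau (r # T) \<longleftrightarrow> r \<noteq> [] \<and> is_row r \<and> below (first_row T) r \<and> is_tableau T"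

abbreviation shape :: "'a list list \<Rightarrow> nat list" where
  "shape \<equiv> map length"

text \<open>The reading word, from the bottom row to the top row.\<close>

abbreviation rows_word :: "'a list list \<Rightarrow> 'a list" where
  "rows_word T \<equiv> concat (rev T)"

text \<open>\<open>insert_row T w U\<close>: inserting \<open>w\<close> in the first row of \<open>T\<close>, the bumped letters in the second
  row, and so on, gives \<open>U\<close>. The word that reaches the bottom forms a new row, unless it is empty.\<close>

inductive insert_row ::
  "'a::signed_alphabet list list \<Rightarrow> 'a list \<Rightarrow> 'a list list \<Rightarrow> bool" where
  insert_row_empty: "insert_row [] [] []"
| insert_row_new: "w \<noteq> [] \<Longrightarrow> insert_row [] w [w]"
| insert_row_Cons: "\<lbrakk>bump r w s e t; insert_row T e U\<rbrakk> \<Longrightarrow> insert_row (r # T) w ((s @ t) # U)"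

text \<open>\<open>mu\<^sub>1 \<ge> lam\<^sub>1 \<ge> mu\<^sub>2 \<ge> lam\<^sub>2 \<ge> \<dots>\<close>, where \<open>mu\<close> has at most one part
  more than \<open>lam\<close>. For partitions this holds iff \<open>mu/lam\<close> is a horizontal strip.\<close>

fun interlaced :: "nat list \<Rightarrow> nat list \<Rightarrow> bool" where
  "interlaced [] mu \<longleftrightarrow> length mu \<le> 1"
| "interlaced (a # lam) [] \<longleftrightarrow> False"
| "interlaced (a # lam) (b # mu) \<longleftrightarrow>
     a \<le> b \<and> (mu \<noteq> [] \<longrightarrow> hd mu \<le> a) \<and> interlaced lam mu"

lemma shape_in_partitions: "is_tableau T \<Longrightarrow> shape T \<in> partitions (sum_list (shape T))"
proof (induction T)
  case (Cons r T)
  then have "length (first_row T) \<le> length r" using below_length by auto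
  then have "\<forall>k\<in>set (shape T). k \<le> length r"
    using Cons by (cases T) (auto simp: partitions_def intro: order_trans)
  then show ?case using Cons by (auto simp: partitions_def)
qed (simp add: partitions_def)

lemma insert_row_exists: "\<exists>U. insert_row T w U"
proof (induction T arbitrary: w)
  case Nil
  then show ?case by (cases "w = []") (auto intro: insert_row.intros)
next
  case (Cons r T)
  obtain s e t where b: "bump r w s e t" using bump_exists by blast
  obtain U where "insert_row T e U" using Cons.IH by blast
  from insert_row_Cons[OF b this] show ?case by blast
qed

lemma insert_row_functional: "insert_row T w U \<Longrightarrow> insert_row T w U' \<Longrightarrow> U' = U"
proof (induction arbitrary: U' rule: insert_row.induct)
  case (insert_row_Cons r w s e t T U)
  note hyps = insert_row_Cons.hyps and IH = insert_row_Cons.IH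
  from insert_row_Cons.prems show ?case
  proof (cases rule: insert_row.cases)
    case (insert_row_Cons s' e' t' U1)
    then show ?thesis using bump_functional[OF hyps(1) insert_row_Cons(2)] IH by blast
  qed
qed (auto elim: insert_row.cases)

text \<open>The result of the insertion, as a function.\<close>

definition insertion :: "'a::signed_alphabet list list \<Rightarrow> 'a list \<Rightarrow> 'a list list" where
  "insertion T w = (THE U. insert_row T w U)"

lemma insertion_eq_iff: "insertion T w = U \<longleftrightarrow> insert_row T w U"
proof -
  obtain V where V: "insert_row T w V" using insert_row_exists by blast
  then have "insertion T w = V"
    unfolding insertion_def using insert_row_functional by blast
  then show ?thesis using V insert_row_functional by blast
qed

text \<open>The shape of \<open>T\<close> has to be known: it determines where the new rows \<open>s @ t\<close> are split.\<close>

lemma insert_row_injective: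
  assumes "insert_row T w U" "insert_row T' w' U" "is_tableau T" "is_tableau T'"
    and "shape T' = shape T"
  shows "T' = T \<and> w' = w"
  using assms
proof (induction arbitrary: T' w' rule: insert_row.induct)
  case (insert_row_Cons r w s e t T U)
  note hyps = insert_row_Cons.hyps and IH = insert_row_Cons.IH and prems = insert_row_Cons.prems
  from prems(1) show ?case
  proof (cases rule: insert_row.cases)
    case insert_row_new
    then show ?thesis using prems(4) by simp
  next
    case (insert_row_Cons r' s' e' t' T1)
    have "length r' = length r" using prems(4) insert_row_Cons by simp
    then have st: "s' = s" "t' = t"
      using insert_row_Cons(2,3) bump_length[OF hyps(1)] bump_length[OF insert_row_Cons(3)] by auto
    have "T1 = T \<and> e' = e"
      using IH[OF insert_row_Cons(4)] prems insert_row_Cons(1) by auto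
    moreover from this have "r' = r \<and> w' = w"
      using bump_injective[OF hyps(1), of r' w'] insert_row_Cons(1,3) st prems by auto
    ultimately show ?thesis using insert_row_Cons(1) by simp
  qed
qed (auto elim: insert_row.cases)

lemma insert_row_top_below:
  assumes "insert_row T e U" "bump r w s e t" "is_tableau (r # T)" "is_row w"
  shows "below (first_row U) s"
  using assms(1)
proof (cases rule: insert_row.cases)
  case insert_row_empty
  then show ?thesis by simp
next
  case insert_row_new
  then show ?thesis using bump_rows[OF assms(2)] assms by simp
next
  case (insert_row_Cons r2 s2 e2 t2 T2 U2)
  then show ?thesis
    using bump_preserves_below[of r w s e t r2 0] assms by simp
qed

lemma insert_row_tableau:
  assumes "insert_row T w U" "is_tableau T" "is_row w"
  shows "is_tableau U \<and> interlaced (shape T) (shape U) \<and>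
    sum_list (shape U) = sum_list (shape T) + length w \<and>
    plactic_equiv (rows_word T @ w) (rows_word U)"
  using assms
proof (induction rule: insert_row.induct)
  case (insert_row_Cons r w s e t T U)
  note b = insert_row_Cons.hyps(1) and prems = insert_row_Cons.prems
  have r: "is_row r" "r \<noteq> []" and T: "is_tableau T" using prems by auto
  have rows: "is_row (s @ t)" "is_row e" using bump_rows[OF b r(1) prems(2)] by auto
  note IH = insert_row_Cons.IH[OF T rows(2)]
  note len = bump_length[OF b]
  have top: "below (first_row U) s"
    using insert_row_top_below[OF insert_row_Cons.hyps(2) b prems] .
  have "is_tableau ((s @ t) # U)"
    using rows IH below_append[OF top] len r(2) by auto
  moreover have "interlaced (shape (r # T)) (shape ((s @ t) # U))"
    using IH len below_length[OF top] by (cases U) auto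
  moreover have "sum_list (shape ((s @ t) # U)) = sum_list (shape (r # T)) + length w"
    using IH len by simp
  moreover have "plactic_equiv (rows_word (r # T) @ w) (rows_word ((s @ t) # U))"
  proof -
    have "plactic_equiv (rows_word T @ r @ w) (rows_word T @ e @ s @ t)"
      by (intro plactic_append_left bump_plactic b r prems)
    moreover have "plactic_equiv ((rows_word T @ e) @ s @ t) (rows_word U @ s @ t)"
      using IH by (intro plactic_append_right) auto
    ultimately show ?thesis by (auto intro: plactic_trans)
  qed
  ultimately show ?case by blast
qed (auto intro: plactic_refl)

lemma insert_row_surjective:
  assumes "is_tableau U" "interlaced lam (shape U)" "0 \<notin> set lam"
  shows "\<exists>T w. is_tableau T \<and> shape T = lam \<and> is_row w \<and> insert_row T w U"
  using assms
proof (induction lam arbitrary: U)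
  case Nil
  show ?case
  proof (cases U)
    case Nil
    then show ?thesis
      using Nil.prems insert_row_empty by (metis is_tableau.simps(1) list.map(1) sorted_wrt.simps(1))
  next
    case (Cons r U')
    then have "U = [r]" "r \<noteq> []" "is_row r" using Nil.prems by auto
    then show ?thesis
      using insert_row_new[of r] by (metis is_tableau.simps(1) list.map(1))
  qed
next
  case (Cons a lam)
  then obtain q U' where U: "U = q # U'" by (cases U) auto
  have lens: "a \<le> length q" "interlaced lam (shape U')" "length (first_row U') \<le> a"
    using Cons.prems(2) U by (cases U'; auto)+
  obtain T e where T: "is_tableau T" "shape T = lam" "is_row e" "insert_row T e U'"
    using Cons.IH[OF _ lens(2)] Cons.prems U by auto
  define s t where "s = take a q" and "t = drop a q"
  have st: "q = s @ t" "length s = a" using lens(1) by (auto simp: s_def t_def)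
  have q: "is_row (s @ t)" "is_row s" and U': "below (first_row U') s"
    using Cons.prems(1) U st lens(3) below_appendD by (auto simp: sorted_wrt_append)
  \<comment> \<open>The letters of \<open>e\<close> occur in this order in the first row of \<open>U'\<close>, which lies below \<open>s\<close>.\<close>
  have "below e s"
    using T(4)
  proof (cases rule: insert_row.cases)
    case (insert_row_Cons r2 s2 e2 t2 T2 U2)
    then show ?thesis
      using below_subseq[of e "s2 @ t2" s] bump_subseq[of r2 e] q(2) U' by auto
  qed (use U' in auto)
  then obtain r w where rw: "is_row r" "is_row w" "bump r w s e t"
    using bump_surjective q(1) T(3) by blast
  have "below (first_row T) r"
    using T(4)
  proof (cases rule: insert_row.cases)
    case (insert_row_Cons r2 s2 e2 t2 T2 U2)
    then show ?thesis
      using bump_reflects_below[OF rw(3), of r2 s2 e2 t2] rw T(1) U' by auto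
  qed auto
  moreover have "length r = a" using bump_length[OF rw(3)] st by simp
  ultimately have "is_tableau (r # T)" "shape (r # T) = a # lam"
    using T rw Cons.prems(3) by auto
  moreover have "insert_row (r # T) w U"
    unfolding U st(1) using rw(3) T(4) by (rule insert_row_Cons)
  ultimately show ?case using rw(2) by (intro exI conjI)
qed

section \<open>Horizontal strips and interlacing partitions\<close>

lemma partition_nth_pos:
  assumes "lam \<in> partitions n" "i < length lam"
  shows "0 < lam ! i"
  using assms nth_mem[OF assms(2)] by (cases "lam ! i") (auto simp: partitions_def)

lemma partition_nth_antimono:
  assumes "lam \<in> partitions n" "i \<le> j" "j < length lam"
  shows "lam ! j \<le> lam ! i"
  using assms sorted_wrt_nth_less[of "(\<ge>)" lam i j] by (cases "i = j") (auto simp: partitions_def)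

lemma horizontal_strip_iff_interlaced:
  assumes lam: "lam \<in> partitions n" and mu: "mu \<in> partitions m"
  shows "diagram lam \<subseteq> diagram mu \<and> inj_on snd (diagram mu - diagram lam) \<longleftrightarrow> interlaced lam mu"
proof -
  have interlaced_iff_nth: "interlaced lam mu \<longleftrightarrow>
      length lam \<le> length mu \<and> length mu \<le> Suc (length lam) \<and>
      (\<forall>i<length lam. lam ! i \<le> mu ! i) \<and> (\<forall>i. Suc i < length mu \<longrightarrow> mu ! Suc i \<le> lam ! i)"
    (is "_ \<longleftrightarrow> ?N lam mu") for lam mu
  proof (induction lam mu rule: interlaced.induct)
    case (3 a lam b mu)
    have *: "(\<forall>i<length mu. mu ! i \<le> (a # lam) ! i) \<longleftrightarrow>
        (mu \<noteq> [] \<longrightarrow> hd mu \<le> a) \<and> (\<forall>i. Suc i < length mu \<longrightarrow> mu ! Suc i \<le> lam ! i)"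
      by (cases mu) (auto simp: All_less_Suc2)
    show ?case using 3 by (simp add: * All_less_Suc2) blast
  qed auto
  note lam_pos = partition_nth_pos[OF lam] and lam_dec = partition_nth_antimono[OF lam]
  note mu_pos = partition_nth_pos[OF mu] and mu_dec = partition_nth_antimono[OF mu]
  have in_diagram: "(Suc i, j) \<in> diagram nu \<longleftrightarrow> i < length nu \<and> 1 \<le> j \<and> j \<le> nu ! i" for i j nu
    by (auto simp: diagram_def)
  show ?thesis
    unfolding interlaced_iff_nth
  proof (intro iffI conjI allI impI; (elim conjE)?)
    assume sub: "diagram lam \<subseteq> diagram mu" and inj: "inj_on snd (diagram mu - diagram lam)"
    have rows: "i < length mu \<and> lam ! i \<le> mu ! i" if "i < length lam" for i
    proof -
      have "(Suc i, lam ! i) \<in> diagram mu"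
        using that lam_pos[OF that] by (intro subsetD[OF sub]) (simp add: in_diagram)
      then show ?thesis by (simp add: in_diagram)
    qed
    \<comment> \<open>Otherwise the box at the end of row \<open>i + 2\<close> and the one above it both lie in \<open>mu/lam\<close>.\<close>
    have strip: "i < length lam \<and> mu ! Suc i \<le> lam ! i" if "Suc i < length mu" for i
    proof (rule ccontr)
      assume neg: "\<not> ?thesis"
      let ?j = "mu ! Suc i"
      have "(Suc i, ?j) \<in> diagram mu - diagram lam" "(Suc (Suc i), ?j) \<in> diagram mu - diagram lam"
        using that neg mu_pos[OF that] mu_dec[of i "Suc i"] lam_dec[of i "Suc i"]
        by (auto simp: in_diagram)
      from inj_onD[OF inj _ this] show False by simp
    qed
    show "length lam \<le> length mu" using rows by (meson not_le_imp_less less_irrefl)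
    show "length mu \<le> Suc (length lam)" using strip[of "length lam"] by force
    show "lam ! i \<le> mu ! i" if "i < length lam" for i using rows[OF that] by simp
    show "mu ! Suc i \<le> lam ! i" if "Suc i < length mu" for i using strip[OF that] by simp
  next
    assume *: "length lam \<le> length mu" "length mu \<le> Suc (length lam)"
      "\<forall>i<length lam. lam ! i \<le> mu ! i" "\<forall>i. Suc i < length mu \<longrightarrow> mu ! Suc i \<le> lam ! i"
    show "diagram lam \<subseteq> diagram mu"
    proof
      fix b assume b: "b \<in> diagram lam"
      then obtain i j where "b = (Suc i, j)" by (cases b; cases "fst b") (auto simp: diagram_def)
      then show "b \<in> diagram mu" using b * by (force simp: in_diagram)
    qed
    have clash: False if "i < i'" "(Suc i, j) \<notin> diagram lam" "(Suc i', j) \<in> diagram mu" for i i' j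
    proof -
      have "j \<le> mu ! i'" "i' < length mu" "1 \<le> j" using that(3) by (auto simp: in_diagram)
      then have "j \<le> mu ! Suc i" "Suc i < length mu"
        using mu_dec[of "Suc i" i'] that(1) by auto
      then have "j \<le> lam ! i" "i < length lam" using *(2,4) by force+
      with that(2) \<open>1 \<le> j\<close> show False by (simp add: in_diagram)
    qed
    show "inj_on snd (diagram mu - diagram lam)"
    proof (rule inj_onI)
      fix b c assume b: "b \<in> diagram mu - diagram lam" and c: "c \<in> diagram mu - diagram lam"
        and "snd b = snd c"
      then obtain i i' j where "b = (Suc i, j)" "c = (Suc i', j)"
        by (cases b; cases c; cases "fst b"; cases "fst c") (auto simp: diagram_def)
      then show "b = c"
        using clash[of i i' j] clash[of i' i j] b c by (cases i i' rule: linorder_cases) auto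
    qed
  qed
qed

lemma horizontal_strip_extensions_eq:
  assumes "lam \<in> partitions n"
  shows "horizontal_strip_extensions lam m = {mu \<in> partitions m. interlaced lam mu}"
  using horizontal_strip_iff_interlaced[OF assms] by (auto simp: horizontal_strip_extensions_def)

section \<open>Tableaux as fillings and as lists of rows\<close>

definition row_tableaux :: "nat list \<Rightarrow> 'a::signed_alphabet list list set" where
  "row_tableaux lam = {T. is_tableau T \<and> shape T = lam}"

text \<open>The rows of a filling, from top to bottom. The list of rows determines the filling because
  fillings are extensional.\<close>

definition rows_of :: "'a tableau \<Rightarrow> 'a list list" where
  "rows_of T = (case T of (lam, t) \<Rightarrow>
     map (\<lambda>i. map (\<lambda>j. t (i, j)) [1..<lam ! (i - 1) + 1]) [1..<length lam + 1])"

lemma reading_word_eq: "reading_word T = rows_word (rows_of T)"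
  by (cases T) (simp add: reading_word_def rows_of_def rev_map)

lemma shape_rows_of: "shape (rows_of (lam, t)) = lam"
  by (rule nth_equalityI) (auto simp: rows_of_def simp del: upt_Suc)

lemma rows_of_nth:
  "i < length lam \<Longrightarrow> j < lam ! i \<Longrightarrow> rows_of (lam, t) ! i ! j = t (Suc i, Suc j)"
  by (simp add: rows_of_def del: upt_Suc)

lemma is_tableau_iff_nth: "is_tableau T \<longleftrightarrow>
    (\<forall>i<length T. T ! i \<noteq> [] \<and> is_row (T ! i)) \<and>
    (\<forall>i. Suc i < length T \<longrightarrow> below (T ! Suc i) (T ! i))"
proof (induction T)
  case (Cons r T)
  have split: "(\<forall>i. P i) \<longleftrightarrow> P 0 \<and> (\<forall>i. P (Suc i))" for P :: "nat \<Rightarrow> bool"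
    by (metis not0_implies_Suc)
  have "(\<forall>i. Suc i < length (r # T) \<longrightarrow> below ((r # T) ! Suc i) ((r # T) ! i)) \<longleftrightarrow>
      below (first_row T) r \<and> (\<forall>i. Suc i < length T \<longrightarrow> below (T ! Suc i) (T ! i))"
    by (subst split) (cases T; simp)
  moreover have "(\<forall>i<length (r # T). (r # T) ! i \<noteq> [] \<and> is_row ((r # T) ! i)) \<longleftrightarrow>
      (r \<noteq> [] \<and> is_row r) \<and> (\<forall>i<length T. T ! i \<noteq> [] \<and> is_row (T ! i))"
    by (subst split) simp
  ultimately show ?case unfolding is_tableau.simps Cons.IH by blast
qed simp

lemma is_row_iff_nth:
  "is_row w \<longleftrightarrow> (\<forall>i. Suc i < length w \<longrightarrow> row_le (w ! i) (w ! Suc i))"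
  by (subst sorted_wrt_iff_nth_Suc_transp) (auto intro: transpI row_le_trans)

lemma row_words_eq: "row_words p = {w. is_row w \<and> length w = p}"
  by (auto simp: row_words_def is_row_iff_nth row_le_def)

lemma is_tableau_rows_of_iff:
  assumes "lam \<in> partitions n"
  shows "is_tableau (rows_of (lam, t)) \<longleftrightarrow>
    (\<forall>i j. i < length lam \<and> Suc j < lam ! i \<longrightarrow> row_le (t (Suc i, Suc j)) (t (Suc i, Suc (Suc j)))) \<and>
    (\<forall>i j. Suc i < length lam \<and> j < lam ! Suc i \<longrightarrow> col_le (t (Suc i, Suc j)) (t (Suc (Suc i), Suc j)))"
proof -
  let ?T = "rows_of (lam, t)"
  have len: "length ?T = length lam" "\<And>i. i < length lam \<Longrightarrow> length (?T ! i) = lam ! i"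
    using shape_rows_of[of lam t] by (metis length_map, metis length_map nth_map)
  have pos: "?T ! i \<noteq> []" if "i < length lam" for i
    using partition_nth_pos[OF assms that] len(2)[OF that] by auto
  have dec: "lam ! Suc i \<le> lam ! i" if "Suc i < length lam" for i
    using partition_nth_antimono[OF assms _ that] by simp
  have "is_row (?T ! i) \<longleftrightarrow>
      (\<forall>j. Suc j < lam ! i \<longrightarrow> row_le (t (Suc i, Suc j)) (t (Suc i, Suc (Suc j))))"
    if "i < length lam" for i
    using that len by (simp add: is_row_iff_nth rows_of_nth)
  moreover have "below (?T ! Suc i) (?T ! i) \<longleftrightarrow>
      (\<forall>j<lam ! Suc i. col_le (t (Suc i, Suc j)) (t (Suc (Suc i), Suc j)))"
    if "Suc i < length lam" for i
    using that len dec[OF that] by (auto simp: below_iff_nth rows_of_nth)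
  ultimately show ?thesis
    unfolding is_tableau_iff_nth len(1) using pos by blast
qed

lemma tableaux_eq:
  assumes "lam \<in> partitions n"
  shows "tableaux lam = {(lam, t) | t. t \<in> diagram lam \<rightarrow>\<^sub>E UNIV \<and> is_tableau (rows_of (lam, t))}"
proof -
  have dec: "lam ! Suc i \<le> lam ! i" if "Suc i < length lam" for i
    using partition_nth_antimono[OF assms _ that] by simp
  have row: "(\<forall>i j. (i, j) \<in> diagram lam \<and> (i, j + 1) \<in> diagram lam \<longrightarrow> P i j) \<longleftrightarrow>
      (\<forall>i j. i < length lam \<and> Suc j < lam ! i \<longrightarrow> P (Suc i) (Suc j))" (is "?l \<longleftrightarrow> ?r") for P
  proof
    assume ?l
    then show ?r by (auto simp: diagram_def)
  next
    assume r: ?r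
    show ?l
    proof (intro allI impI)
      fix i j assume "(i, j) \<in> diagram lam \<and> (i, j + 1) \<in> diagram lam"
      then show "P i j" using r[rule_format, of "i - 1" "j - 1"] by (auto simp: diagram_def)
    qed
  qed
  have col: "(\<forall>i j. (i, j) \<in> diagram lam \<and> (i + 1, j) \<in> diagram lam \<longrightarrow> P i j) \<longleftrightarrow>
      (\<forall>i j. Suc i < length lam \<and> j < lam ! Suc i \<longrightarrow> P (Suc i) (Suc j))" (is "?l \<longleftrightarrow> ?r") for P
  proof
    assume ?l
    then show ?r using dec by (fastforce simp: diagram_def)
  next
    assume r: ?r
    show ?l
    proof (intro allI impI)
      fix i j assume "(i, j) \<in> diagram lam \<and> (i + 1, j) \<in> diagram lam"
      then show "P i j" using r[rule_format, of "i - 1" "j - 1"] by (auto simp: diagram_def)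
    qed
  qed
  show ?thesis
    unfolding tableaux_def row col is_tableau_rows_of_iff[OF assms] row_le_def col_le_def by simp
qed

lemma rows_of_bij:
  assumes lam: "lam \<in> partitions n"
  shows "bij_betw rows_of (tableaux lam :: 'a::signed_alphabet tableau set) (row_tableaux lam)"
    (is "bij_betw _ ?A ?B")
proof (rule bij_betw_imageI)
  show "inj_on rows_of ?A"
  proof (rule inj_onI)
    fix T T' :: "'a tableau"
    assume "T \<in> ?A" "T' \<in> ?A" and eq: "rows_of T = rows_of T'"
    then obtain t t' where T: "T = (lam, t)" "T' = (lam, t')"
      "t \<in> diagram lam \<rightarrow>\<^sub>E UNIV" "t' \<in> diagram lam \<rightarrow>\<^sub>E UNIV"
      unfolding tableaux_eq[OF lam] by auto
    have "t b = t' b" if "b \<in> diagram lam" for b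
    proof -
      have "\<exists>i j. b = (Suc i, Suc j) \<and> i < length lam \<and> j < lam ! i"
        using that
        by (intro exI[of _ "snd b - 1"] exI[of _ "fst b - 1"]) (auto simp: diagram_def)
      then obtain i j where "b = (Suc i, Suc j)" "i < length lam" "j < lam ! i" by blast
      then show ?thesis using eq rows_of_nth[of i lam j t] rows_of_nth[of i lam j t'] T by simp
    qed
    then have "t = t'" by (rule PiE_ext[OF T(3,4)])
    then show "T = T'" using T by simp
  qed
  show "rows_of ` ?A = ?B"
  proof
    show "rows_of ` ?A \<subseteq> ?B"
      unfolding tableaux_eq[OF lam] row_tableaux_def using shape_rows_of by auto
    show "?B \<subseteq> rows_of ` ?A"
    proof
      fix T :: "'a list list" assume "T \<in> ?B"
      then have T: "is_tableau T" "shape T = lam" by (auto simp: row_tableaux_def)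
      define t where "t = (\<lambda>b\<in>diagram lam. T ! (fst b - 1) ! (snd b - 1))"
      have "rows_of (lam, t) = T"
      proof (rule nth_equalityI)
        show len: "length (rows_of (lam, t)) = length T"
          using T(2) shape_rows_of[of lam t] by (metis length_map)
        fix i assume "i < length (rows_of (lam, t))"
        then have i: "i < length T" "i < length lam" using len T(2) by auto
        have li: "length (T ! i) = lam ! i" using i T(2) by auto
        show "rows_of (lam, t) ! i = T ! i"
        proof (rule nth_equalityI)
          show "length (rows_of (lam, t) ! i) = length (T ! i)"
            using i li shape_rows_of[of lam t] len by (metis nth_map)
          fix j assume "j < length (rows_of (lam, t) ! i)"
          then have "j < lam ! i" using i shape_rows_of[of lam t] len by (metis nth_map)
          then show "rows_of (lam, t) ! i ! j = T ! i ! j"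
            using i by (simp add: rows_of_nth t_def diagram_def)
        qed
      qed
      moreover have "t \<in> diagram lam \<rightarrow>\<^sub>E UNIV" by (simp add: t_def)
      ultimately show "T \<in> rows_of ` ?A"
        unfolding tableaux_eq[OF lam] using T(1) by (intro image_eqI[of _ _ "(lam, t)"]) auto
    qed
  qed
qed

section \<open>Sums in the plactic ring\<close>

lemma S_shape_eq:
  assumes "lam \<in> partitions n"
  shows "S_shape lam = (\<Sum>T\<in>row_tableaux lam. word_elem (rows_word T))"
  unfolding S_shape_def reading_word_eq by (rule sum.reindex_bij_betw[OF rows_of_bij[OF assms]])

lemma finite_row_tableaux:
  assumes "lam \<in> partitions n"
  shows "finite (row_tableaux lam :: 'a::{finite,signed_alphabet} list list set)"
  using bij_betw_finite[OF rows_of_bij[OF assms]] finite_tableaux by blast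

lemma word_elem_mult: "word_elem u * word_elem v = word_elem (u @ v)"
  by (simp add: word_elem_def mult_single plus_plactic.abs_eq)

lemma word_elem_cong: "plactic_equiv u v \<Longrightarrow> word_elem u = word_elem v"
  using plactic.abs_eq_iff[of u v] by (simp add: word_elem_def)

lemma insertion_bij:
  assumes lam: "lam \<in> partitions n"
  shows "bij_betw (\<lambda>(T, w). insertion T w)
    (row_tableaux lam \<times> row_words p :: ('a::signed_alphabet list list \<times> 'a list) set)
    (\<Union>mu\<in>horizontal_strip_extensions lam (n + p). row_tableaux mu)"
    (is "bij_betw ?f ?A ?B")
proof (rule bij_betw_imageI)
  show "inj_on ?f ?A"
  proof (rule inj_onI, clarify)
    fix T T' :: "'a list list" and w w' :: "'a list"
    assume "T \<in> row_tableaux lam" "T' \<in> row_tableaux lam" "insertion T w = insertion T' w'"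
    then show "T = T' \<and> w = w'"
      using insert_row_injective[of T' w' "insertion T' w'" T w]
      by (auto simp: insertion_eq_iff[symmetric] row_tableaux_def)
  qed
  show "?f ` ?A = ?B"
  proof
    show "?f ` ?A \<subseteq> ?B"
    proof
      fix U assume "U \<in> ?f ` ?A"
      then obtain T w where "T \<in> row_tableaux lam" "w \<in> row_words p" "insert_row T w U"
        by (auto simp: insertion_eq_iff[symmetric])
      then have T: "is_tableau T" "shape T = lam" "is_row w" "length w = p" "insert_row T w U"
        by (auto simp: row_tableaux_def row_words_eq)
      note U = insert_row_tableau[OF T(5,1,3)]
      then have "shape U \<in> horizontal_strip_extensions lam (n + p)"
        using T lam shape_in_partitions[of U]
        unfolding horizontal_strip_extensions_eq[OF lam] by (simp add: partitions_def)
      then show "U \<in> ?B" using U by (auto simp: row_tableaux_def)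
    qed
    show "?B \<subseteq> ?f ` ?A"
    proof
      fix U :: "'a list list" assume "U \<in> ?B"
      then have U: "is_tableau U" "interlaced lam (shape U)" "sum_list (shape U) = n + p"
        unfolding horizontal_strip_extensions_eq[OF lam]
        by (auto simp: row_tableaux_def partitions_def)
      obtain T w where T: "is_tableau T" "shape T = lam" "is_row w" "insert_row T w U"
        using insert_row_surjective[OF U(1,2)] lam by (auto simp: partitions_def)
      have "length w = p"
        using insert_row_tableau[OF T(4,1,3)] T(2) U(3) lam by (simp add: partitions_def)
      then show "U \<in> ?f ` ?A"
        using T
        by (intro image_eqI[of _ _ "(T, w)"])
          (simp_all add: insertion_eq_iff[symmetric] row_tableaux_def row_words_eq)
    qed
  qed
qed

theorem theorem3p14:
  fixes lam :: "nat list" and n p :: nat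
  assumes proper: "(even_letters :: 'a::{finite,signed_alphabet} set) \<noteq> {}"
      "(odd_letters :: 'a set) \<noteq> {}"
    and lam: "lam \<in> partitions n"
    and p: "p \<ge> 1"
  shows "(S_shape lam :: 'a plactic_ring) * S_row p
       = (\<Sum>mu\<in>horizontal_strip_extensions lam (n + p). S_shape mu)"
proof -
  let ?H = "horizontal_strip_extensions lam (n + p)"
  let ?A = "row_tableaux lam \<times> row_words p :: ('a list list \<times> 'a list) set"
  have H: "mu \<in> partitions (n + p)" if "mu \<in> ?H" for mu
    using that by (simp add: horizontal_strip_extensions_def)
  have eq: "word_elem (rows_word T) * word_elem w = word_elem (rows_word (insertion T w))"
    if "(T, w) \<in> ?A" for T w
  proof -
    have "plactic_equiv (rows_word T @ w) (rows_word (insertion T w))"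
      using insert_row_tableau[of T w "insertion T w"] that
      by (simp add: insertion_eq_iff[symmetric] row_tableaux_def row_words_eq)
    then show ?thesis by (simp add: word_elem_mult word_elem_cong)
  qed
  have "S_shape lam * S_row p
      = (\<Sum>(T, w)\<in>?A. word_elem (rows_word T) * word_elem w :: 'a plactic_ring)"
    by (simp add: S_shape_eq[OF lam] S_row_def sum_product sum.cartesian_product)
  also have "\<dots> = (\<Sum>x\<in>?A. word_elem (rows_word ((\<lambda>(T, w). insertion T w) x)))"
    using eq by (intro sum.cong) auto
  also have "\<dots> = (\<Sum>U\<in>(\<Union>mu\<in>?H. row_tableaux mu). word_elem (rows_word U))"
    by (rule sum.reindex_bij_betw[OF insertion_bij[OF lam]])
  also have "\<dots> = (\<Sum>mu\<in>?H. \<Sum>U\<in>row_tableaux mu. word_elem (rows_word U))"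
    by (intro sum.UNION_disjoint finite_horizontal_strip_extensions)
      (blast intro: finite_row_tableaux H, auto simp: row_tableaux_def)
  also have "\<dots> = (\<Sum>mu\<in>?H. S_shape mu)"
    by (intro sum.cong refl S_shape_eq[OF H, symmetric])
  finally show ?thesis .
qed

end
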